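(* Let $n, b$ be positive integers with $b \le n$, let $\boldsymbol\theta = (\theta_1, \dots, \theta_b) \in \mathbb{R}^b$ with $\theta_1 \neq 0$, and let $\mathbf{C}(\boldsymbol\theta) \in \mathbb{R}^{n \times n}$ be the lower triangular $b$-banded Toeplitz matrix with Toeplitz coefficients $\boldsymbol\theta$, i.e. $\mathbf{C}(\boldsymbol\theta)_{ij} = \theta_{i-j+1}$ if $1 \le i-j+1 \le b$ and $\mathbf{C}(\boldsymbol\theta)_{ij} = 0$ otherwise, for $1 \le i,j \le n$. Let $\mathbf{A} \in \mathbb{R}^{n\times n}$ be the lower triangular matrix of ones ($A_{ij} = 1$ if $i \ge j$ and $A_{ij} = 0$ otherwise), let $\mathbf{1} \in \mathbb{R}^n$ be the all-ones vector, and let $\mathbf{w} = (w_1,\dots,w_n)^\top = \mathbf{C}(\boldsymbol\theta)^{-1}\mathbf{1} \in \mathbb{R}^n$. Then the two factors that determine the expected total squared error of the strategy $\mathbf{C}(\boldsymbol\theta)$ on the workload $\mathbf{A}$ are given by $$\|\mathbf{C}(\boldsymbol\theta)\|_{1,2} = \|\boldsymbol\theta\|_2 \qquad \text{and} \qquad \|\mathbf{A}\,\mathbf{C}(\boldsymbol\theta)^{-1}\|_F^2 = \sum_{i=1}^n (n-i+1)\, w_i^2 .$$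
   Context: For a matrix $\mathbf{M}$, $\|\mathbf{M}\|_{1,2}$ denotes the maximum Euclidean ($L_2$) norm of the columns of $\mathbf{M}$, $\|\mathbf{M}\|_F$ denotes the Frobenius norm, and $\|\cdot\|_2$ is the Euclidean norm of a vector. The expected total squared error of a strategy matrix $\mathbf{C}$ on a workload matrix $\mathbf{A}$ is, up to a factor $\sigma^2$ depending only on the privacy parameters, the number of bands, the number of epochs and the number of iterations (not on the entries of $\mathbf{C}$), the product $\|\mathbf{C}\|_{1,2}^2\,\|\mathbf{A}\mathbf{C}^{-1}\|_F^2$. *)

theory Defs
  imports "Jordan_Normal_Form.Gauss_Jordan_Elimination" "HOL-Analysis.L2_Norm"
begin

(* Vectors and matrices are indexed from 0: theta $ k is the coefficient theta_(k+1) of the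
   k-th subdiagonal, and the number of bands is dim_vec theta. *)
definition banded_toeplitz :: "nat \<Rightarrow> real vec \<Rightarrow> real mat" where
  "banded_toeplitz n \<theta> =
     mat n n (\<lambda>(i, j). if j \<le> i \<and> i - j < dim_vec \<theta> then \<theta> $ (i - j) else 0)"

definition prefix_sum_mat :: "nat \<Rightarrow> real mat" where
  "prefix_sum_mat n = mat n n (\<lambda>(i, j). if j \<le> i then 1 else 0)"

definition vec_norm2 :: "real vec \<Rightarrow> real" where
  "vec_norm2 v = L2_set (\<lambda>i. v $ i) {..<dim_vec v}"

(* The maximal Euclidean norm of a column; only meaningful for matrices with at least one column. *)
definition mat_norm12 :: "real mat \<Rightarrow> real" where
  "mat_norm12 M = Max ((\<lambda>j. vec_norm2 (col M j)) ` {..<dim_col M})"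

definition frobenius_norm :: "real mat \<Rightarrow> real" where
  "frobenius_norm M = L2_set (\<lambda>ij. M $$ ij) ({..<dim_row M} \<times> {..<dim_col M})"

(* Unspecified for singular matrices, where mat_inverse returns None. *)
definition mat_inv :: "real mat \<Rightarrow> real mat" where
  "mat_inv M = the (mat_inverse M)"

lemma mat_inv_correct:
  assumes M: "M \<in> carrier_mat n n" and inv: "invertible_mat M"
  shows "mat_inv M \<in> carrier_mat n n" "M * mat_inv M = 1\<^sub>m n" "mat_inv M * M = 1\<^sub>m n"
proof -
  from inv obtain B where B: "M * B = 1\<^sub>m (dim_row M)" "B * M = 1\<^sub>m (dim_row B)"
    unfolding invertible_mat_def inverts_mat_def by blast
  have "dim_col (M * B) = n" "dim_col (B * M) = dim_row B"
    using B M by simp_all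
  then have Bc: "B \<in> carrier_mat n n" using M by auto
  then have "M \<in> Units (ring_mat TYPE(real) n ())"
    using B M unfolding Units_def ring_mat_def by auto
  then obtain B' where "mat_inverse M = Some B'"
    using mat_inverse(1)[OF M, of "()"] by (cases "mat_inverse M") auto
  then show "mat_inv M \<in> carrier_mat n n" "M * mat_inv M = 1\<^sub>m n" "mat_inv M * M = 1\<^sub>m n"
    using mat_inverse(2)[OF M] by (auto simp: mat_inv_def)
qed

end

theory Submission
  imports Defs "HOL-Computational_Algebra.Formal_Power_Series"
begin

text \<open>
  Truncation at order \<open>n\<close> identifies lower triangular Toeplitz matrices with power series, matrix
  product with Cauchy product. If \<open>f\<close> is the polynomial with coefficients \<open>\<theta>\<close>, the matrix
  \<open>A C(\<theta>)\<^sup>-\<^sup>1\<close> is therefore the Toeplitz matrix of \<open>h = (1 + X + X\<^sup>2 + \<dots>) / f\<close>, and \<open>w\<close> is its first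
  column. The coefficient of index \<open>k\<close> of \<open>h\<close> occurs \<open>n - k\<close> times in this matrix.
\<close>

definition toeplitz :: "nat \<Rightarrow> 'a :: zero fps \<Rightarrow> 'a mat" where
  "toeplitz n f = mat n n (\<lambda>(i, j). if j \<le> i then fps_nth f (i - j) else 0)"

lemma toeplitz_carrier [simp]: "toeplitz n f \<in> carrier_mat n n"
  by (simp add: toeplitz_def)

lemma dim_toeplitz [simp]: "dim_row (toeplitz n f) = n" "dim_col (toeplitz n f) = n"
  by (simp_all add: toeplitz_def)

lemma toeplitz_index:
  "i < n \<Longrightarrow> j < n \<Longrightarrow> toeplitz n f $$ (i, j) = (if j \<le> i then fps_nth f (i - j) else 0)"
  by (simp add: toeplitz_def)

lemma toeplitz_one: "toeplitz n (1 :: 'a :: semiring_1 fps) = 1\<^sub>m n"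
  by (rule eq_matI) (auto simp: toeplitz_def)

lemma toeplitz_mult:
  fixes f g :: "'a :: comm_semiring_1 fps"
  shows "toeplitz n f * toeplitz n g = toeplitz n (f * g)"
proof (rule eq_matI)
  fix i j assume "i < dim_row (toeplitz n (f * g))" "j < dim_col (toeplitz n (f * g))"
  then have ij: "i < n" "j < n" by simp_all
  have "(toeplitz n f * toeplitz n g) $$ (i, j)
      = (\<Sum>k<n. toeplitz n f $$ (i, k) * toeplitz n g $$ (k, j))"
    using ij by (simp add: scalar_prod_def atLeast0LessThan)
  \<comment> \<open>A term with \<open>k > i\<close> or \<open>k < j\<close> has a factor above the
    diagonal. For \<open>i < j\<close> the interval is empty, in agreement with the zero entry of
    the product.\<close>
  also have "\<dots> = (\<Sum>k\<in>{j..i}. fps_nth f (i - k) * fps_nth g (k - j))"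
    using ij by (intro sum.mono_neutral_cong_right) (auto simp: toeplitz_index)
  also have "\<dots> = toeplitz n (f * g) $$ (i, j)"
  proof (cases "j \<le> i")
    case True
    then have "(\<Sum>k\<in>{j..i}. fps_nth f (i - k) * fps_nth g (k - j))
        = (\<Sum>m\<in>{0..i - j}. fps_nth f m * fps_nth g (i - j - m))"
      by (intro sum.reindex_bij_witness[of _ "\<lambda>m. i - m" "\<lambda>k. i - k"])
        (auto simp: diff_right_commute)
    then show ?thesis
      using True ij by (simp add: toeplitz_index fps_mult_nth)
  qed (use ij in \<open>simp add: toeplitz_index\<close>)
  finally show "(toeplitz n f * toeplitz n g) $$ (i, j) = toeplitz n (f * g) $$ (i, j)" .
qed simp_all

lemma toeplitz_inverse:
  fixes f :: "'a :: field fps"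
  assumes "fps_nth f 0 \<noteq> 0"
  shows "toeplitz n f * toeplitz n (inverse f) = 1\<^sub>m n"
    and "toeplitz n (inverse f) * toeplitz n f = 1\<^sub>m n"
  using inverse_mult_eq_1[OF assms] inverse_mult_eq_1'[OF assms]
  by (simp_all add: toeplitz_mult toeplitz_one)

lemma invertible_toeplitz:
  fixes f :: "'a :: field fps"
  assumes "fps_nth f 0 \<noteq> 0"
  shows "invertible_mat (toeplitz n f)"
  using toeplitz_inverse[OF assms, of n]
  unfolding invertible_mat_def inverts_mat_def by auto

text \<open>\<open>mat_inv\<close> is known only as some two-sided inverse; uniqueness of inverses
  identifies it with the Toeplitz matrix of the reciprocal series.\<close>

lemma mat_inv_toeplitz:
  assumes "fps_nth f 0 \<noteq> 0"
  shows "mat_inv (toeplitz n f) = toeplitz n (inverse f)"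
proof -
  note inv = mat_inv_correct[OF toeplitz_carrier invertible_toeplitz[OF assms], of n]
  have "mat_inv (toeplitz n f) = mat_inv (toeplitz n f) * (toeplitz n f * toeplitz n (inverse f))"
    using inv(1) by (simp add: toeplitz_inverse(1)[OF assms])
  also have "\<dots> = mat_inv (toeplitz n f) * toeplitz n f * toeplitz n (inverse f)"
    by (rule assoc_mult_mat[symmetric, OF inv(1)]) (rule toeplitz_carrier)+
  also have "\<dots> = toeplitz n (inverse f)"
    by (simp add: inv(3))
  finally show ?thesis .
qed

text \<open>The all-ones vector is column 0 of the Toeplitz matrix of the geometric series, so its
  image is column 0 of the product matrix.\<close>

lemma toeplitz_mult_ones:
  fixes f :: "'a :: comm_semiring_1 fps"
  assumes "i < n"
  shows "(toeplitz n f *\<^sub>v vec n (\<lambda>_. 1)) $ i = fps_nth (f * Abs_fps (\<lambda>_. 1)) i"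
proof -
  have "(toeplitz n f *\<^sub>v vec n (\<lambda>_. 1)) $ i = (\<Sum>j<n. toeplitz n f $$ (i, j))"
    using assms by (simp add: scalar_prod_def atLeast0LessThan)
  also have "\<dots> = (\<Sum>j\<in>{0..i}. fps_nth f (i - j))"
    using assms by (intro sum.mono_neutral_cong_right) (auto simp: toeplitz_index)
  also have "\<dots> = (\<Sum>m\<in>{0..i}. fps_nth f m)"
    by (rule sum.reindex_bij_witness[of _ "\<lambda>m. i - m" "\<lambda>j. i - j"]) auto
  finally show ?thesis
    by (simp add: fps_mult_nth)
qed

lemma frobenius_norm_toeplitz:
  "(frobenius_norm (toeplitz n f))\<^sup>2 = (\<Sum>k<n. real (n - k) * (fps_nth f k)\<^sup>2)"
proof -
  have "(frobenius_norm (toeplitz n f))\<^sup>2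
      = (\<Sum>(i, j)\<in>{..<n} \<times> {..<n}. (toeplitz n f $$ (i, j))\<^sup>2)"
    by (simp add: frobenius_norm_def L2_set_def sum_nonneg case_prod_unfold)
  also have "\<dots> = (\<Sum>(i, j)\<in>(SIGMA i:{..<n}. {..i}). (fps_nth f (i - j))\<^sup>2)"
    by (intro sum.mono_neutral_cong_right) (auto simp: toeplitz_index split: if_splits)
  \<comment> \<open>Group the entries by subdiagonal \<open>k = i - j\<close>: the bound
    \<open>i < n\<close> becomes \<open>j < n - k\<close>, so each coefficient is counted
    \<open>n - k\<close> times.\<close>
  also have "\<dots> = (\<Sum>(k, j)\<in>(SIGMA k:{..<n}. {..<n - k}). (fps_nth f k)\<^sup>2)"
    by (rule sum.reindex_bij_witness[of _ "\<lambda>(k, j). (k + j, j)" "\<lambda>(i, j). (i - j, j)"]) auto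
  also have "\<dots> = (\<Sum>k<n. real (n - k) * (fps_nth f k)\<^sup>2)"
    by (subst sum.Sigma[symmetric]) auto
  finally show ?thesis .
qed

text \<open>Each column holds an initial segment of \<theta>, cut off by the bottom edge of the
  matrix. Column 0 holds all of \<theta>, since the band fits into \<open>n\<close> rows, and so
  attains the maximum.\<close>

lemma mat_norm12_banded_toeplitz:
  assumes "dim_vec \<theta> \<le> n" and "0 < n"
  shows "mat_norm12 (banded_toeplitz n \<theta>) = vec_norm2 \<theta>"
proof -
  have col: "vec_norm2 (col (banded_toeplitz n \<theta>) j) = L2_set (\<lambda>k. \<theta> $ k) {..<min (dim_vec \<theta>) (n - j)}"
    if "j < n" for j
  proof -
    have "(\<Sum>i<n. (banded_toeplitz n \<theta> $$ (i, j))\<^sup>2)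
        = (\<Sum>i | j \<le> i \<and> i < n \<and> i - j < dim_vec \<theta>. (\<theta> $ (i - j))\<^sup>2)"
      using that by (intro sum.mono_neutral_cong_right) (auto simp: banded_toeplitz_def)
    also have "\<dots> = (\<Sum>k<min (dim_vec \<theta>) (n - j). (\<theta> $ k)\<^sup>2)"
      by (rule sum.reindex_bij_witness[of _ "\<lambda>k. k + j" "\<lambda>i. i - j"]) auto
    finally have "(\<Sum>i<n. (banded_toeplitz n \<theta> $$ (i, j))\<^sup>2)
        = (\<Sum>k<min (dim_vec \<theta>) (n - j). (\<theta> $ k)\<^sup>2)" .
    moreover have "dim_row (banded_toeplitz n \<theta>) = n" "dim_col (banded_toeplitz n \<theta>) = n"
      by (simp_all add: banded_toeplitz_def)
    ultimately show ?thesis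
      using that by (simp add: vec_norm2_def L2_set_def)
  qed
  have "dim_col (banded_toeplitz n \<theta>) = n"
    by (simp add: banded_toeplitz_def)
  moreover have "Max ((\<lambda>j. vec_norm2 (col (banded_toeplitz n \<theta>) j)) ` {..<n}) = vec_norm2 \<theta>"
  proof (rule Max_eqI)
    fix y assume "y \<in> (\<lambda>j. vec_norm2 (col (banded_toeplitz n \<theta>) j)) ` {..<n}"
    then obtain j where "j < n" "y = L2_set (\<lambda>k. \<theta> $ k) {..<min (dim_vec \<theta>) (n - j)}"
      by (auto simp: col)
    then show "y \<le> vec_norm2 \<theta>"
      by (auto simp: vec_norm2_def L2_set_def intro!: sum_mono2)
  next
    have "vec_norm2 \<theta> = vec_norm2 (col (banded_toeplitz n \<theta>) 0)"
      using assms col[of 0] by (simp add: vec_norm2_def[of \<theta>] min_absorb1)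
    then show "vec_norm2 \<theta> \<in> (\<lambda>j. vec_norm2 (col (banded_toeplitz n \<theta>) j)) ` {..<n}"
      using assms by blast
  qed simp
  ultimately show ?thesis
    by (simp add: mat_norm12_def)
qed

theorem proposition3p1:
  fixes n b :: nat and \<theta> w :: "real vec"
  assumes "1 \<le> b" and "b \<le> n"
    and "\<theta> \<in> carrier_vec b" and "\<theta> $ 0 \<noteq> 0"
    and "w = mat_inv (banded_toeplitz n \<theta>) *\<^sub>v vec n (\<lambda>_. 1)"
  shows "invertible_mat (banded_toeplitz n \<theta>)
    \<and> mat_norm12 (banded_toeplitz n \<theta>) = vec_norm2 \<theta>
    \<and> (frobenius_norm (prefix_sum_mat n * mat_inv (banded_toeplitz n \<theta>)))\<^sup>2
        = (\<Sum>i = 1..n. real (n - i + 1) * (w $ (i - 1))\<^sup>2)"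
proof (intro conjI)
  \<comment> \<open>Padding with zeros encodes the band: entries below it are coefficients of
    \<open>f\<close> of index at least \<open>dim_vec \<theta>\<close>.\<close>
  define f where "f = Abs_fps (\<lambda>k. if k < dim_vec \<theta> then \<theta> $ k else 0)"
  define g where "g = (Abs_fps (\<lambda>_. 1) :: real fps)"
  have C: "banded_toeplitz n \<theta> = toeplitz n f"
    by (rule eq_matI) (auto simp: banded_toeplitz_def toeplitz_def f_def)
  have A: "prefix_sum_mat n = toeplitz n g"
    by (rule eq_matI) (auto simp: prefix_sum_mat_def toeplitz_def g_def)
  have f0: "fps_nth f 0 \<noteq> 0"
    using assms by (auto simp: f_def)
  show "invertible_mat (banded_toeplitz n \<theta>)"
    by (simp add: C invertible_toeplitz f0)
  show "mat_norm12 (banded_toeplitz n \<theta>) = vec_norm2 \<theta>"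
    using assms by (intro mat_norm12_banded_toeplitz) auto
  \<comment> \<open>By definition \<open>w\<close> belongs to \<open>inverse f * g\<close>, the
    matrix in the Frobenius norm to \<open>g * inverse f\<close>; commutativity of power series
    makes them agree.\<close>
  have w: "w $ k = fps_nth (g * inverse f) k" if "k < n" for k
    using that assms(5)
    by (simp add: C mat_inv_toeplitz[OF f0] toeplitz_mult_ones g_def mult.commute
        del: index_mult_mat_vec)
  have "(frobenius_norm (prefix_sum_mat n * mat_inv (banded_toeplitz n \<theta>)))\<^sup>2
      = (\<Sum>k<n. real (n - k) * (w $ k)\<^sup>2)"
    by (simp add: A C mat_inv_toeplitz[OF f0] toeplitz_mult frobenius_norm_toeplitz w)
  \<comment> \<open>Shift to indices from 1 by \<open>i = k + 1\<close>; since
    \<open>i \<le> n\<close>, the truncated difference satisfies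
    \<open>n - (i - 1) = n - i + 1\<close>.\<close>
  also have "\<dots> = (\<Sum>i = 1..n. real (n - i + 1) * (w $ (i - 1))\<^sup>2)"
    by (rule sum.reindex_bij_witness[of _ "\<lambda>i. i - 1" Suc]) auto
  finally show "(frobenius_norm (prefix_sum_mat n * mat_inv (banded_toeplitz n \<theta>)))\<^sup>2
      = (\<Sum>i = 1..n. real (n - i + 1) * (w $ (i - 1))\<^sup>2)" .
qed

end
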